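(* Let $p>3$ be a prime. Then $$\sum_{k=0}^{(p-1)/2}(21k+8)\binom{2k}{k}^3\equiv 8p+(-1)^{(p-1)/2}32p^3E_{p-3}\pmod{p^4}$$ and $$\sum_{k=1}^{(p-1)/2}\frac{21k-8}{k^3\binom{2k}{k}^3}\equiv(-1)^{(p+1)/2}4E_{p-3}\pmod p.$$
   Context: The Euler numbers $E_0,E_1,E_2,\ldots$ are the integers given by $E_0=1$ and the recursion $\sum_{0\leqslant k\leqslant n,\ 2\mid k}\binom{n}{k}E_{n-k}=0$ for $n=1,2,3,\ldots$. Congruences modulo a power $p^a$ between rational numbers are understood in the ring of rational numbers whose denominators are not divisible by $p$. *)

theory Defs
  imports Complex_Main "HOL-Number_Theory.Number_Theory"
begin

(* The recursion for the Euler numbers, solved for its k = 0 term. *)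
function euler_number :: "nat \<Rightarrow> int" where
  "euler_number n =
     (if n = 0 then 1
      else - (\<Sum>k\<in>{k\<in>{1..n}. even k}. int (n choose k) * euler_number (n - k)))"
  by auto
termination by (relation "measure id") auto

declare euler_number.simps [simp del]

lemma euler_number_0: "euler_number 0 = 1"
  by (simp add: euler_number.simps)

lemma euler_number_recursion:
  assumes "n \<ge> 1"
  shows "(\<Sum>k\<in>{k\<in>{0..n}. even k}. int (n choose k) * euler_number (n - k)) = 0"
proof -
  let ?A = "{k\<in>{1..n}. even k}"
  have eq: "{k\<in>{0..n}. even k} = insert 0 ?A"
    by (auto intro: Suc_leI gr0I)
  have "finite ?A" and "0 \<notin> ?A"
    by simp_all
  then show ?thesis
    unfolding eq using assms by (subst sum.insert) (simp_all add: euler_number.simps[of n])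
qed

(* quotient_of returns numerator and denominator in lowest terms. *)
definition p_integral :: "nat \<Rightarrow> rat set" where
  "p_integral p = {x. \<not> int p dvd snd (quotient_of x)}"

(* Congruence modulo p ^ a in the ring p_integral p; both sides are required to lie
   in that ring. *)
definition p_cong :: "nat \<Rightarrow> nat \<Rightarrow> rat \<Rightarrow> rat \<Rightarrow> bool" where
  "p_cong p a x y \<longleftrightarrow>
     x \<in> p_integral p \<and> y \<in> p_integral p \<and>
     (\<exists>z\<in>p_integral p. x - y = of_nat p ^ a * z)"

(* Between integers this is the usual congruence. *)
lemma p_cong_of_int_iff:
  assumes "prime p"
  shows "p_cong p a (of_int m) (of_int n) \<longleftrightarrow> [m = n] (mod int p ^ a)"
proof
  assume "p_cong p a (of_int m) (of_int n)"
  then obtain z where z: "z \<in> p_integral p" and eq: "of_int m - of_int n = of_nat p ^ a * z"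
    unfolding p_cong_def by blast
  obtain u v where uv: "quotient_of z = (u, v)" by (cases "quotient_of z")
  have v: "v > 0" "z = of_int u / of_int v"
    using quotient_of_denom_pos[OF uv] quotient_of_div[OF uv] by auto
  have "of_int ((m - n) * v) = (of_int (int p ^ a * u) :: rat)"
    using eq v by (simp add: field_simps)
  then have "(m - n) * v = int p ^ a * u"
    by (simp only: of_int_eq_iff)
  then have "int p ^ a dvd (m - n) * v"
    by simp
  moreover have "\<not> int p dvd v"
    using z uv by (simp add: p_integral_def)
  then have "coprime (int p ^ a) v"
    using assms prime_imp_coprime[of "int p" v] by simp
  ultimately show "[m = n] (mod int p ^ a)"
    by (simp add: cong_iff_dvd_diff coprime_dvd_mult_left_iff)
next
  assume "[m = n] (mod int p ^ a)"
  then obtain u where "m - n = int p ^ a * u"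
    by (auto simp: cong_iff_dvd_diff dvd_def)
  then have "of_int m - of_int n = of_nat p ^ a * (of_int u :: rat)"
    by (metis of_int_diff of_int_mult of_int_of_nat_eq of_int_power)
  moreover have "of_int w \<in> p_integral p" for w
    using assms by (auto simp: p_integral_def)
  ultimately show "p_cong p a (of_int m) (of_int n)"
    unfolding p_cong_def by blast
qed

end

(*
  The inverse central binomial sum T(n) = sum_{k=1..n} (21k - 8) / (k^3 C(2k,k)^3) and Apery's sum
  3 sum_{k=1..n} 1 / (k^2 C(2k,k)) are path sums of the WZ pair n!^4 k!^2 / ((2n)! (n+k+1)!^2), and a
  second WZ pair links the latter to -2 sum_{k=1..n} (-1)^k / k^2. For n = (p-1)/2 the two error terms
  agree modulo p, term by term, by Wilson's theorem in the form m! (p-1-m)! = (-1)^(m+1) mod p. Hence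
  T((p-1)/2) is congruent modulo p to -2 sum_{k=1..(p-1)/2} (-1)^k / k^2, which is a multiple of
  E_{p-3} because alternating power sums over a full period satisfy the Euler recursion modulo p.

  For the first congruence, the dual WZ pair evaluates the sum over k < p as
  4p C(2p,p) sum_{k<p} C(p+k-1,k)^2, which is 8p modulo p^4 by Wolstenholme. The tail k > p/2 is
  reduced to T((p-1)/2) by the congruence of C(2(p-j),p-j) with -2p / (j C(2j,j)) modulo p^2.
*)

theory Submission
  imports Defs
begin

subsection \<open>Rational numbers integral at a prime\<close>

locale prime_modulus =
  fixes p :: nat
  assumes p: "prime p"
begin

text \<open>The denominator in lowest terms divides any other denominator of the same number, so
  integrality can be tested on an unreduced fraction.\<close>

lemma p_integral_divide: "of_int a / of_int b \<in> p_integral p" if "\<not> int p dvd b"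
proof -
  let ?x = "of_int a / of_int b :: rat"
  obtain u v where uv: "quotient_of ?x = (u, v)" by (cases "quotient_of ?x")
  have "v > 0" "?x = of_int u / of_int v"
    using quotient_of_denom_pos[OF uv] quotient_of_div[OF uv] by auto
  moreover have "b \<noteq> 0" using that by auto
  ultimately have "of_int (u * b) = (of_int (a * v) :: rat)"
    by (simp add: field_simps)
  then have "u * b = a * v" by (simp only: of_int_eq_iff)
  then have "v dvd u * b" by (metis dvd_triv_right)
  moreover have "coprime v u" using quotient_of_coprime[OF uv] by (simp add: coprime_commute)
  ultimately have "v dvd b" by (simp add: coprime_dvd_mult_right_iff)
  then show ?thesis using that uv dvd_trans by (auto simp: p_integral_def)
qed

lemma p_integralE:
  assumes "x \<in> p_integral p"
  obtains a b where "\<not> int p dvd b" "x = of_int a / of_int b"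
  using assms quotient_of_div[of x] by (cases "quotient_of x") (auto simp: p_integral_def)

lemma p_integral_of_int [simp]: "of_int a \<in> p_integral p"
  using p_integral_divide[of 1 a] prime_gt_1_nat[OF p] by (simp add: zdvd1_eq)

lemma p_integral_of_nat [simp]: "of_nat a \<in> p_integral p"
  using p_integral_of_int[of "int a"] by simp

lemma p_integral_numeral [simp]: "numeral a \<in> p_integral p"
  using p_integral_of_int[of "numeral a"] by simp

lemma p_integral_0 [simp]: "0 \<in> p_integral p" and p_integral_1 [simp]: "1 \<in> p_integral p"
  using p_integral_of_int[of 0] p_integral_of_int[of 1] by simp_all

lemma p_integral_fact [simp]: "fact n \<in> p_integral p"
  using p_integral_of_nat[of "fact n"] by simp

lemma p_integral_add [simp]:
  assumes "x \<in> p_integral p" "y \<in> p_integral p"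
  shows "x + y \<in> p_integral p"
proof -
  obtain a b where ab: "\<not> int p dvd b" "x = of_int a / of_int b"
    using assms(1) by (rule p_integralE)
  obtain c d where cd: "\<not> int p dvd d" "y = of_int c / of_int d"
    using assms(2) by (rule p_integralE)
  have "\<not> int p dvd b * d" using ab cd p by (simp add: prime_dvd_mult_iff)
  moreover have "x + y = of_int (a * d + c * b) / of_int (b * d)"
    using ab cd by (subst ab(2), subst cd(2), subst add_frac_eq) auto
  ultimately show ?thesis by (metis p_integral_divide)
qed

lemma p_integral_mult [simp]:
  assumes "x \<in> p_integral p" "y \<in> p_integral p"
  shows "x * y \<in> p_integral p"
proof -
  obtain a b where ab: "\<not> int p dvd b" "x = of_int a / of_int b"
    using assms(1) by (rule p_integralE)
  obtain c d where cd: "\<not> int p dvd d" "y = of_int c / of_int d"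
    using assms(2) by (rule p_integralE)
  have "\<not> int p dvd b * d" using ab cd p by (simp add: prime_dvd_mult_iff)
  moreover have "x * y = of_int (a * c) / of_int (b * d)"
    using ab cd by simp
  ultimately show ?thesis by (metis p_integral_divide)
qed

lemma p_integral_uminus [simp]: "x \<in> p_integral p \<Longrightarrow> - x \<in> p_integral p"
  using p_integral_mult[of "of_int (-1)" x] p_integral_of_int[of "-1"] by simp

lemma p_integral_power [simp]: "x \<in> p_integral p \<Longrightarrow> x ^ n \<in> p_integral p"
  by (induction n) simp_all

lemma p_integral_sum: "(\<And>i. i \<in> A \<Longrightarrow> f i \<in> p_integral p) \<Longrightarrow> sum f A \<in> p_integral p"
  by (induction A rule: infinite_finite_induct) simp_all

lemma p_integral_inverse_of_nat:
  assumes "\<not> p dvd n"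
  shows "inverse (of_nat n) \<in> p_integral p"
  using p_integral_divide[of "int n" 1] assms by (simp add: divide_inverse)

section \<open>Calculus of congruences between \<open>p\<close>-integral rationals\<close>

lemma p_cong_refl: "x \<in> p_integral p \<Longrightarrow> p_cong p a x x"
  by (auto simp: p_cong_def intro: bexI[of _ 0])

lemma p_cong_sym: "p_cong p a x y \<Longrightarrow> p_cong p a y x"
  unfolding p_cong_def by (metis minus_diff_eq mult_minus_right p_integral_uminus)

lemma p_cong_add:
  assumes "p_cong p a x y" "p_cong p a x' y'"
  shows "p_cong p a (x + x') (y + y')"
proof -
  obtain z z' where "z \<in> p_integral p" "z' \<in> p_integral p"
    "x - y = of_nat p ^ a * z" "x' - y' = of_nat p ^ a * z'"
    using assms unfolding p_cong_def by blast
  then have "z + z' \<in> p_integral p" "x + x' - (y + y') = of_nat p ^ a * (z + z')"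
    by (simp_all add: algebra_simps)
  then show ?thesis using assms unfolding p_cong_def by auto
qed

lemma p_cong_trans [trans]:
  assumes "p_cong p a x y" "p_cong p a y z"
  shows "p_cong p a x z"
  using p_cong_add[OF assms] assms unfolding p_cong_def by simp

lemma p_cong_mult:
  assumes "p_cong p a x y" "p_cong p a x' y'"
  shows "p_cong p a (x * x') (y * y')"
proof -
  obtain z z' where "z \<in> p_integral p" "z' \<in> p_integral p"
    "x - y = of_nat p ^ a * z" "x' - y' = of_nat p ^ a * z'"
    using assms unfolding p_cong_def by blast
  moreover have "x * x' - y * y' = (x - y) * x' + y * (x' - y')"
    by (simp add: algebra_simps)
  ultimately have "x * x' - y * y' = of_nat p ^ a * (z * x' + y * z')"
    "z * x' + y * z' \<in> p_integral p"
    using assms by (simp_all add: algebra_simps p_cong_def)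
  then show ?thesis using assms unfolding p_cong_def by auto
qed

lemma p_cong_cmult: "c \<in> p_integral p \<Longrightarrow> p_cong p a x y \<Longrightarrow> p_cong p a (c * x) (c * y)"
  by (intro p_cong_mult p_cong_refl)

lemma p_cong_power: "p_cong p a x y \<Longrightarrow> p_cong p a (x ^ n) (y ^ n)"
  by (induction n) (auto intro: p_cong_mult p_cong_refl)

lemma p_cong_uminus: "p_cong p a x y \<Longrightarrow> p_cong p a (- x) (- y)"
  using p_cong_cmult[of "-1" a x y] by simp

lemma p_cong_diff: "p_cong p a x y \<Longrightarrow> p_cong p a x' y' \<Longrightarrow> p_cong p a (x - x') (y - y')"
  using p_cong_add[of a x y "- x'" "- y'"] p_cong_uminus[of a x' y'] by simp

lemma p_cong_sum:
  "(\<And>i. i \<in> A \<Longrightarrow> p_cong p a (f i) (g i)) \<Longrightarrow> p_cong p a (sum f A) (sum g A)"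
  by (induction A rule: infinite_finite_induct) (auto intro: p_cong_add p_cong_refl)

text \<open>Explicit factors of \<open>p\<close> buy precision: this is how facts modulo
  \<open>p\<close> suffice for results modulo \<open>p ^ 3\<close> and \<open>p ^ 4\<close>.\<close>

lemma p_cong_shift:
  assumes "p_cong p a x y"
  shows "p_cong p (a + b) (of_nat p ^ b * x) (of_nat p ^ b * y)"
proof -
  obtain z where "z \<in> p_integral p" "x - y = of_nat p ^ a * z"
    using assms unfolding p_cong_def by blast
  moreover from this have "of_nat p ^ b * x - of_nat p ^ b * y = of_nat p ^ (a + b) * z"
    by (simp add: power_add flip: right_diff_distrib)
  ultimately show ?thesis using assms unfolding p_cong_def by auto
qed

lemma p_cong_of_nat_self: "p_cong p 1 (of_nat p) 0"
  unfolding p_cong_def by (auto intro: bexI[of _ 1])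

lemma p_cong_inverse_of_nat:
  assumes "\<not> p dvd n" "p_cong p a (of_nat n * y) 1" "y \<in> p_integral p"
  shows "p_cong p a (inverse (of_nat n)) y"
proof -
  have "n \<noteq> 0" using assms(1) by (metis dvd_0_right)
  then show ?thesis
    using p_cong_cmult[OF p_integral_inverse_of_nat[OF assms(1)] p_cong_sym[OF assms(2)]]
    by (simp flip: mult.assoc)
qed

lemma p_cong_cancel_of_nat:
  assumes "\<not> p dvd n" "p_cong p a (of_nat n * x) (of_nat n * y)"
  shows "p_cong p a x y"
proof -
  have "n \<noteq> 0" using assms(1) by (metis dvd_0_right)
  then show ?thesis
    using p_cong_cmult[OF p_integral_inverse_of_nat[OF assms(1)] assms(2)]
    by (simp flip: mult.assoc)
qed

lemma p_cong_of_int: "[m = n] (mod int p ^ a) \<Longrightarrow> p_cong p a (of_int m) (of_int n)"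
  using p_cong_of_int_iff[OF p] by blast

subsection \<open>Factorials and binomial coefficients modulo a prime\<close>

text \<open>Induction starting from Wilson's theorem, the case \<open>m = 0\<close>. The products
  for \<open>m\<close> and \<open>Suc m\<close> share the factor
  \<open>fact (p - 1 - Suc m) * fact m\<close>, with cofactors \<open>p - 1 - m\<close> and
  \<open>m + 1\<close> that add up to \<open>p\<close>, so they are opposite modulo
  \<open>p\<close>.\<close>

lemma fact_mult_fact_cong:
  "m < p \<Longrightarrow> [fact (p - 1 - m) * fact m = (-1) ^ (m + 1)] (mod int p)"
proof (induction m)
  case 0
  then show ?case using wilson_theorem[OF p] by simp
next
  case (Suc m)
  have e: "p - 1 - m = Suc (p - 1 - Suc m)" using Suc.prems by simp
  have "fact (p - 1 - Suc m) * fact (Suc m) + fact (p - 1 - m) * fact m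
      = int p * (fact (p - 1 - Suc m) * fact m)"
    unfolding e fact_Suc using Suc.prems by (simp add: of_nat_diff algebra_simps)
  then have "[fact (p - 1 - Suc m) * fact (Suc m) + fact (p - 1 - m) * fact m = 0] (mod int p)"
    by (simp add: cong_0_iff)
  then have "[fact (p - 1 - Suc m) * fact (Suc m) = - (fact (p - 1 - m) * fact m)] (mod int p)"
    by (simp add: cong_iff_dvd_diff)
  also have "[- (fact (p - 1 - m) * fact m) = - ((-1) ^ (m + 1))] (mod int p)"
    using Suc.IH Suc.prems by (subst cong_minus_minus_iff) simp
  finally show ?case by simp
qed

text \<open>Trades a factorial in a denominator for one in a numerator, which makes quotients of
  factorials comparable modulo \<open>p\<close>.\<close>

lemma inverse_fact_cong:
  assumes "m < p"
  shows "p_cong p 1 (inverse (fact m)) ((-1) ^ (m + 1) * fact (p - 1 - m))"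
proof -
  have "\<not> p dvd fact m" using assms p by (simp add: prime_dvd_fact_iff)
  moreover have "p_cong p 1 (of_int ((-1) ^ (m + 1) * (fact (p - 1 - m) * fact m)))
      (of_int ((-1) ^ (m + 1) * (-1) ^ (m + 1)))"
    using fact_mult_fact_cong[OF assms] by (intro p_cong_of_int cong_mult cong_refl) simp
  then have "p_cong p 1 (of_nat (fact m) * ((-1) ^ (m + 1) * fact (p - 1 - m))) 1"
    by (simp add: mult_ac flip: power_add power_mult_distrib)
  ultimately show ?thesis
    using p_cong_inverse_of_nat[of "fact m"] by simp
qed

text \<open>Each step multiplies the coefficient by \<open>(p + Suc j) / Suc j\<close>, which is 1
  modulo \<open>p\<close> as long as \<open>Suc j < p\<close>.\<close>

lemma choose_add_cong: "j < p \<Longrightarrow> p_cong p 1 (of_nat ((p + j) choose j)) 1"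
proof (induction j)
  case 0
  then show ?case by (simp add: p_cong_refl)
next
  case (Suc j)
  have "Suc j * ((p + Suc j) choose Suc j) = (p + Suc j) * ((p + j) choose j)"
    using Suc_times_binomial[of j "p + j"] by simp
  then have "(of_nat (Suc j) * of_nat ((p + Suc j) choose Suc j) :: rat)
     = (of_nat p + of_nat (Suc j)) * of_nat ((p + j) choose j)"
    by (simp only: flip: of_nat_mult of_nat_add)
  moreover have "p_cong p 1 ((of_nat p + of_nat (Suc j)) * of_nat ((p + j) choose j))
      ((0 + of_nat (Suc j)) * 1)"
    using Suc by (intro p_cong_mult p_cong_add p_cong_of_nat_self p_cong_refl) simp_all
  ultimately have "p_cong p 1 (of_nat (Suc j) * of_nat ((p + Suc j) choose Suc j))
      (of_nat (Suc j) * 1)"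
    by simp
  moreover have "\<not> p dvd Suc j" using Suc.prems by (auto dest: dvd_imp_le)
  ultimately show ?case by (rule p_cong_cancel_of_nat[rotated])
qed

text \<open>Neighbours in row \<open>p - 1\<close> of Pascal's triangle add up to an inner entry of
  row \<open>p\<close>, a multiple of \<open>p\<close>, so the entries alternate in sign from 1
  on.\<close>

lemma choose_prime_minus_1_cong: "j < p \<Longrightarrow> p_cong p 1 (of_nat ((p - 1) choose j)) ((-1) ^ j)"
proof (induction j)
  case 0
  then show ?case by (simp add: p_cong_refl)
next
  case (Suc j)
  have "p dvd p choose Suc j" using Suc.prems p by (intro dvd_choose_prime) auto
  moreover have "p choose Suc j = ((p - 1) choose j) + ((p - 1) choose Suc j)"
    using prime_gt_0_nat[OF p] by (subst choose_reduce_nat) simp_all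
  ultimately have "[int ((p - 1) choose Suc j) = - int ((p - 1) choose j)] (mod int p ^ 1)"
    by (simp add: cong_iff_dvd_diff add.commute flip: of_nat_add)
  from p_cong_of_int[OF this] Suc show ?case
    by (auto dest: p_cong_uminus intro: p_cong_trans)
qed

end

subsection \<open>Hypergeometric identities\<close>

lemma central_binomial_eq: "of_nat ((2 * n) choose n) = (fact (2 * n) / fact n ^ 2 :: rat)"
  by (simp add: binomial_fact power2_eq_square)

lemma fact_double_Suc:
  "fact (2 * Suc n) = (2 * of_nat n + 2) * (2 * of_nat n + 1) * (fact (2 * n) :: rat)"
  by (simp add: algebra_simps)

text \<open>Induction on \<open>n\<close>. The summand \<open>u\<close> on the left has a WZ mate
  \<open>v\<close> with \<open>u (Suc n) j - u n j = v (Suc j) - v j\<close>, so raising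
  \<open>n\<close> changes the left side only by boundary terms, and these are the new terms on the
  right.\<close>

lemma inverse_square_central_sum_1:
  "(\<Sum>j<n. (-1) ^ (n + j + 1) * fact j ^ 2 * fact (n - 1 - j) / fact (n + j + 1))
    = - 2 * (\<Sum>k=1..n. (-1) ^ k / of_nat k ^ 2)
      - (3 * (\<Sum>k=1..n. 1 / (of_nat k ^ 2 * of_nat ((2 * k) choose k))) :: rat)"
proof (induction n)
  case 0
  then show ?case by simp
next
  case (Suc n)
  define u where "u n j = ((-1) ^ (n + j + 1) * fact j ^ 2 * fact (n - 1 - j) / fact (n + j + 1) :: rat)"
    for n j :: nat
  define v where "v j = - (2 / of_nat (n + 1)) * ((-1) ^ (n + j) * fact j ^ 2 * fact (n - j)
      / fact (n + j + 1) :: rat)" for j :: nat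
  have step: "u (Suc n) j - u n j = v (Suc j) - v j" if "j < n" for j
  proof -
    \<comment> \<open>Writing \<open>n\<close> as \<open>j + d + 1\<close> removes the truncated
      subtractions; all four terms then become rational multiples of \<open>s * t\<close>.\<close>
    from that obtain d where n: "n = Suc (j + d)"
      by (auto simp: less_iff_Suc_add)
    define t where "t = (fact j ^ 2 * fact d / fact (n + j + 1) :: rat)"
    define s where "s = ((-1) ^ (n + j) :: rat)"
    define x y where "x = (of_nat j :: rat)" and "y = (of_nat d :: rat)"
    have nz: "x + y + 2 \<noteq> 0" "2 * x + y + 3 \<noteq> 0"
      unfolding x_def y_def using of_nat_neq_0[of "j + d + 1"] of_nat_neq_0[of "2 * j + d + 2"]
      by (simp_all add: add_ac)
    have f: "fact (n + j + 2) = (2 * x + y + 3) * (fact (n + j + 1) :: rat)"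
      "fact (n - j) = (y + 1) * (fact d :: rat)" "fact (Suc j) = (x + 1) * (fact j :: rat)"
      unfolding n x_def y_def by (simp_all add: algebra_simps)
    have 1: "u (Suc n) j = s * t * (y + 1) / (2 * x + y + 3)"
      unfolding u_def s_def t_def using f by (simp add: n mult_ac add_ac)
    have 2: "u n j = - s * t"
      unfolding u_def s_def t_def by (simp add: n)
    have 3: "v j = - (2 / (x + y + 2)) * s * t * (y + 1)"
      unfolding v_def s_def t_def f(2) by (simp add: n x_def y_def add_ac)
    have 4: "v (Suc j) = (2 / (x + y + 2)) * s * t * (x + 1) ^ 2 / (2 * x + y + 3)"
      unfolding v_def s_def t_def f(3) using f(1) by (simp add: n x_def y_def add_ac mult_ac power_mult_distrib)
    show ?thesis
      unfolding 1 2 3 4 using nz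
      by (simp add: divide_simps) (simp add: algebra_simps power2_eq_square)
  qed
  define z where "z = (of_nat n :: rat)"
  have nz: "z + 1 \<noteq> 0" "2 * z + 1 \<noteq> 0" "2 * z + 2 \<noteq> 0"
    unfolding z_def using of_nat_neq_0[of n] of_nat_neq_0[of "2 * n"] of_nat_neq_0[of "2 * n + 1"]
    by (simp_all add: add_ac)
  have "(\<Sum>j<Suc n. u (Suc n) j) = (\<Sum>j<n. u n j) + ((\<Sum>j<n. v (Suc j) - v j) + u (Suc n) n)"
    by (simp add: step[symmetric] sum_subtractf)
  also have "(\<Sum>j<n. v (Suc j) - v j) = v n - v 0"
    by (rule sum_lessThan_telescope)
  \<comment> \<open>Here \<open>- v 0\<close> yields the alternating term, while
    \<open>v n + u (Suc n) n\<close> yields the central binomial term.\<close>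
  also have "v n - v 0 + u (Suc n) n = - 2 * ((-1) ^ Suc n / (z + 1) ^ 2)
      - 3 * (1 / ((z + 1) ^ 2 * of_nat ((2 * Suc n) choose Suc n)))"
  proof -
    define c where "c = (fact n ^ 2 / fact (2 * n) :: rat)"
    have e: "n + n = 2 * n" by simp
    have 1: "u (Suc n) n = c / ((2 * z + 1) * (2 * z + 2))"
      unfolding u_def c_def z_def using fact_double_Suc[of n] by (simp add: e mult_ac)
    have 2: "v n = - (2 / (z + 1)) * (c / (2 * z + 1))"
      unfolding v_def c_def z_def by (simp add: e add_ac)
    have 3: "v 0 = - (2 / (z + 1)) * ((-1) ^ n / (z + 1))"
      unfolding v_def z_def by (simp add: add_ac)
    have 4: "1 / of_nat ((2 * Suc n) choose Suc n) = (z + 1) ^ 2 * c / ((2 * z + 2) * (2 * z + 1))"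
      unfolding c_def z_def central_binomial_eq fact_double_Suc
      by (simp add: power_mult_distrib mult_ac add_ac)
    have "v n - v 0 + u (Suc n) n = - 2 * ((-1) ^ Suc n / (z + 1) ^ 2)
      - 3 * (1 / (z + 1) ^ 2 * (1 / of_nat ((2 * Suc n) choose Suc n)))"
      unfolding 1 2 3 4 using nz 
      by (simp add: divide_simps) (simp add: algebra_simps eval_nat_numeral)
    then show ?thesis by simp
  qed
  finally show ?case using Suc.IH unfolding u_def z_def
    by (simp add: algebra_simps)
qed

text \<open>The same WZ scheme. The error sum on the right has this shape so that, for
  \<open>n = (p - 1) / 2\<close>, it can be matched term by term with the left side of
  \<open>inverse_square_central_sum_1\<close>.\<close>

lemma inverse_square_central_sum_2:
  "(\<Sum>k=1..n. (21 * of_nat k - 8) / (of_nat k ^ 3 * of_nat ((2 * k) choose k) ^ 3))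
    = 3 * (\<Sum>k=1..n. 1 / (of_nat k ^ 2 * of_nat ((2 * k) choose k)))
      + (\<Sum>k<n. fact n ^ 4 * fact k ^ 2 / (fact (2 * n) * fact (n + k + 1) ^ 2) :: rat)"
proof (induction n)
  case 0
  then show ?case by simp
next
  case (Suc n)
  define u where "u n k = (fact n ^ 4 * fact k ^ 2 / (fact (2 * n) * fact (n + k + 1) ^ 2) :: rat)"
    for n k :: nat
  define z where "z = (of_nat n :: rat)"
  define v where "v k = (fact n ^ 4 * fact k ^ 2 / (fact (2 * Suc n) * fact (n + k + 1) ^ 2)
      * (2 * (z + 1) * of_nat k + 3 * (z + 1) ^ 2) :: rat)" for k :: nat
  have nz: "z + 1 \<noteq> 0" "2 * z + 1 \<noteq> 0" "2 * z + 2 \<noteq> 0"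
    unfolding z_def using of_nat_neq_0[of n] of_nat_neq_0[of "2 * n"] of_nat_neq_0[of "2 * n + 1"]
    by (simp_all add: add_ac)
  have step: "u (Suc n) k - u n k = v (Suc k) - v k" for k
  proof -
    define t where "t = (fact n ^ 4 * fact k ^ 2 / (fact (2 * n) * fact (n + k + 1) ^ 2) :: rat)"
    define y where "y = (of_nat k :: rat)"
    have nz': "z + y + 2 \<noteq> 0"
      unfolding z_def y_def using of_nat_neq_0[of "n + k + 1"] by (simp add: add_ac)
    have f: "fact (n + k + 2) = (z + y + 2) * (fact (n + k + 1) :: rat)"
      "fact (Suc n) = (z + 1) * (fact n :: rat)" "fact (Suc k) = (y + 1) * (fact k :: rat)"
      "fact (2 * Suc n) = (2 * z + 2) * (2 * z + 1) * (fact (2 * n) :: rat)"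
      unfolding z_def y_def by (simp_all add: algebra_simps)
    have 1: "u (Suc n) k = t * (z + 1) ^ 4 / ((2 * z + 2) * (2 * z + 1) * (z + y + 2) ^ 2)"
      unfolding u_def t_def f(2,4) using f(1) by (simp add: power_mult_distrib mult_ac)
    have 2: "u n k = t"
      unfolding u_def t_def ..
    have 3: "v k = t * (2 * (z + 1) * y + 3 * (z + 1) ^ 2) / ((2 * z + 2) * (2 * z + 1))"
      unfolding v_def t_def f(4) by (simp add: y_def)
    have 4: "v (Suc k) = t * (y + 1) ^ 2 * (2 * (z + 1) * (y + 1) + 3 * (z + 1) ^ 2)
        / ((2 * z + 2) * (2 * z + 1) * (z + y + 2) ^ 2)"
      unfolding v_def t_def f(3,4) using f(1) by (simp add: y_def power_mult_distrib mult_ac add_ac)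
    show ?thesis
      unfolding 1 2 3 4 using nz nz'
      by (simp add: divide_simps) (simp add: algebra_simps power2_eq_square power4_eq_xxxx)
  qed
  have "(\<Sum>k<Suc n. u (Suc n) k) = (\<Sum>k<n. u n k) + ((\<Sum>k<n. v (Suc k) - v k) + u (Suc n) n)"
    by (simp add: step[symmetric] sum_subtractf)
  also have "(\<Sum>k<n. v (Suc k) - v k) = v n - v 0"
    by (rule sum_lessThan_telescope)
  \<comment> \<open>The end \<open>v 0\<close> accounts for Apery's sum; \<open>v n\<close> and the
    new diagonal term \<open>u (Suc n) n\<close> combine to the cubic term, which is where 21 and 8
    arise.\<close>
  also have "v n - v 0 + u (Suc n) n
      = (21 * (z + 1) - 8) / ((z + 1) ^ 3 * of_nat ((2 * Suc n) choose Suc n) ^ 3)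
        - 3 * (1 / ((z + 1) ^ 2 * of_nat ((2 * Suc n) choose Suc n)))"
  proof -
    define c where "c = (fact n ^ 2 / fact (2 * n) :: rat)"
    have e: "n + n = 2 * n" by simp
    have 1: "u (Suc n) n = c ^ 3 * (z + 1) ^ 4 / ((2 * z + 2) ^ 3 * (2 * z + 1) ^ 3)"
    proof -
      have "fact (2 * n + 2) = (2 * z + 2) * (2 * z + 1) * (fact (2 * n) :: rat)"
        using fact_double_Suc[of n] by (simp add: z_def)
      then show ?thesis
        unfolding u_def c_def by (simp add: e z_def power_mult_distrib power_divide
          power2_eq_square power3_eq_cube power4_eq_xxxx mult_ac add_ac)
    qed
    have 2: "v n = c ^ 3 * (5 * z ^ 2 + 8 * z + 3) / ((2 * z + 2) * (2 * z + 1) ^ 3)"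
    proof -
      have "fact (2 * n + 1) = (2 * z + 1) * (fact (2 * n) :: rat)"
        by (simp add: z_def)
      then show ?thesis
        unfolding v_def c_def fact_double_Suc by (simp add: e z_def power_mult_distrib power_divide
          power2_eq_square power3_eq_cube power4_eq_xxxx divide_simps) (simp add: algebra_simps)
    qed
    have 3: "v 0 = 3 * c / ((2 * z + 2) * (2 * z + 1))"
      unfolding v_def c_def fact_double_Suc using nz by (simp add: z_def [symmetric] divide_simps)
        (simp add: algebra_simps power2_eq_square power4_eq_xxxx)
    have 4: "1 / of_nat ((2 * Suc n) choose Suc n) = (z + 1) ^ 2 * c / ((2 * z + 2) * (2 * z + 1))"
      unfolding c_def z_def central_binomial_eq fact_double_Suc
      by (simp add: power_mult_distrib mult_ac add_ac)
    have e': "2 * z + 2 = 2 * (z + 1)" "5 * z ^ 2 + 8 * z + 3 = (5 * z + 3) * (z + 1)"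
      by (simp_all add: algebra_simps power2_eq_square)
    have "v n - v 0 + u (Suc n) n
      = (21 * (z + 1) - 8) / (z + 1) ^ 3 * (1 / of_nat ((2 * Suc n) choose Suc n)) ^ 3
        - 3 * (1 / (z + 1) ^ 2 * (1 / of_nat ((2 * Suc n) choose Suc n)))"
      unfolding 1 2 3 4 e' using nz(1,2)
      by (simp add: divide_simps power_mult_distrib) (simp add: algebra_simps eval_nat_numeral)
    then show ?thesis by (simp add: power_divide)
  qed
  finally show ?case using Suc.IH unfolding u_def z_def
    by (simp add: algebra_simps)
qed

text \<open>The dual WZ pair, again by induction on \<open>n\<close>. At \<open>n = p - 1\<close>
  the prefactor is \<open>4 * p\<close> times the central binomial coefficient of
  \<open>2 * p\<close>, so one factor \<open>p\<close> becomes explicit.\<close>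

lemma central_binomial_cube_sum:
  "(\<Sum>k\<le>n. (21 * of_nat k + 8) * of_nat ((2 * k) choose k) ^ 3 :: rat)
    = 4 * of_nat (Suc n) * of_nat ((2 * Suc n) choose Suc n) * (\<Sum>k\<le>n. of_nat ((n + k) choose k) ^ 2)"
proof (induction n)
  case 0
  then show ?case by simp
next
  case (Suc n)
  define u where "u n k = (4 * of_nat (Suc n) * of_nat ((2 * Suc n) choose Suc n)
      * of_nat ((n + k) choose k) ^ 2 :: rat)" for n k :: nat
  define z where "z = (of_nat n :: rat)"
  define v where "v k = u n k * of_nat k ^ 2 * (2 * of_nat k + 3 * (z + 1)) / (z + 1) ^ 3" for k :: nat
  have nz: "z + 1 \<noteq> 0" "z + 2 \<noteq> 0" "2 * z + 1 \<noteq> 0" "2 * z + 2 \<noteq> 0"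
    unfolding z_def using of_nat_neq_0[of n] of_nat_neq_0[of "n + 1"] of_nat_neq_0[of "2 * n"]
      of_nat_neq_0[of "2 * n + 1"]
    by (simp_all add: add_ac)
  have C: "of_nat ((2 * Suc (Suc n)) choose Suc (Suc n))
      = of_nat ((2 * Suc n) choose Suc n) * (2 * z + 4) * (2 * z + 3) / (z + 2) ^ 2"
    unfolding central_binomial_eq fact_double_Suc[of "Suc n"] using nz(2)
    by (simp add: z_def power_mult_distrib divide_simps) (simp add: algebra_simps)
  have step: "u (Suc n) k - u n k = v (Suc k) - v k" for k
  proof -
    define y where "y = (of_nat k :: rat)"
    define b where "b = (of_nat ((n + k) choose k) :: rat)"
    define c where "c = (of_nat ((2 * Suc n) choose Suc n) :: rat)"
    have nz': "y + 1 \<noteq> 0"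
      unfolding y_def using of_nat_neq_0[of k] by (simp add: add_ac)
    have f: "fact (n + k + 1) = (z + y + 1) * (fact (n + k) :: rat)"
      "fact (Suc n) = (z + 1) * (fact n :: rat)" "fact (Suc k) = (y + 1) * (fact k :: rat)"
      unfolding z_def y_def by (simp_all add: algebra_simps)
    have b: "b = fact (n + k) / (fact k * fact n)"
      unfolding b_def by (simp add: binomial_fact)
    have b1: "of_nat ((Suc n + k) choose k) = b * (z + y + 1) / (z + 1)"
      unfolding b using f(1,2) by (simp add: binomial_fact mult_ac add_ac)
    have b2: "of_nat ((n + Suc k) choose Suc k) = b * (z + y + 1) / (y + 1)"
      unfolding b using f(1,3)
      by (subst binomial_fact) (simp_all add: mult_ac add_ac del: binomial_Suc_Suc)
    have 1: "u (Suc n) k = 4 * (z + 2) * (c * (2 * z + 4) * (2 * z + 3) / (z + 2) ^ 2)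
        * (b * (z + y + 1) / (z + 1)) ^ 2"
      unfolding u_def C b1 c_def by (simp add: z_def)
    have 2: "u n k = 4 * (z + 1) * c * b ^ 2"
      unfolding u_def c_def b_def by (simp add: z_def)
    have 3: "v k = 4 * (z + 1) * c * b ^ 2 * y ^ 2 * (2 * y + 3 * (z + 1)) / (z + 1) ^ 3"
      unfolding v_def 2 by (simp add: y_def)
    have 4: "v (Suc k) = 4 * (z + 1) * c * (b * (z + y + 1) / (y + 1)) ^ 2 * (y + 1) ^ 2
        * (2 * (y + 1) + 3 * (z + 1)) / (z + 1) ^ 3"
      unfolding v_def u_def b2 c_def by (simp add: y_def z_def add_ac)
    \<comment> \<open>Cancelling \<open>z + 2\<close> and \<open>y + 1\<close> leaves the common
      denominator \<open>(z + 1) ^ 2\<close>, so the WZ equation becomes a polynomial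
      identity.\<close>
    have eqs: "u (Suc n) k = 8 * c * (2 * z + 3) * b ^ 2 * (z + y + 1) ^ 2 / (z + 1) ^ 2"
      "v k = 4 * c * b ^ 2 * y ^ 2 * (2 * y + 3 * (z + 1)) / (z + 1) ^ 2"
      "v (Suc k) = 4 * c * b ^ 2 * (z + y + 1) ^ 2 * (2 * (y + 1) + 3 * (z + 1)) / (z + 1) ^ 2"
    proof -
      have w: "x * (z + 1) / (z + 1) ^ 3 = x / (z + 1) ^ 2" for x
        using nz(1) by (simp add: power2_eq_square power3_eq_cube)
      have "4 * (z + 2) * (c * (2 * z + 4) * (2 * z + 3) / (z + 2) ^ 2) = 8 * c * (2 * z + 3)"
        using nz(2) by (simp add: divide_simps) (simp add: algebra_simps power2_eq_square)
      then show "u (Suc n) k = 8 * c * (2 * z + 3) * b ^ 2 * (z + y + 1) ^ 2 / (z + 1) ^ 2"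
        unfolding 1 by (simp add: power_divide power_mult_distrib)
      show "v k = 4 * c * b ^ 2 * y ^ 2 * (2 * y + 3 * (z + 1)) / (z + 1) ^ 2"
        unfolding 3 by (subst w[symmetric]) (simp add: distrib_left distrib_right mult_ac)
      show "v (Suc k) = 4 * c * b ^ 2 * (z + y + 1) ^ 2 * (2 * (y + 1) + 3 * (z + 1)) / (z + 1) ^ 2"
      proof -
        have "(b * (z + y + 1) / (y + 1)) ^ 2 * (y + 1) ^ 2 = b ^ 2 * (z + y + 1) ^ 2"
          using nz' by (simp add: power_divide power_mult_distrib)
        then have "v (Suc k) = 4 * c * b ^ 2 * (z + y + 1) ^ 2 * (2 * (y + 1) + 3 * (z + 1))
            * (z + 1) / (z + 1) ^ 3"
          unfolding 4 by (simp only: mult_ac)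
        then show ?thesis unfolding w .
      qed
    qed
    show ?thesis
      unfolding 2 eqs using nz(1)
      by (simp add: divide_simps) (simp add: algebra_simps eval_nat_numeral)
  qed
  have "(\<Sum>k\<le>Suc n. u (Suc n) k)
      = (\<Sum>k\<le>n. u n k) + ((\<Sum>k<Suc n. v (Suc k) - v k) + u (Suc n) (Suc n))"
    by (simp only: step[symmetric] sum_subtractf lessThan_Suc_atMost) simp
  \<comment> \<open>The factor \<open>of_nat k ^ 2\<close> in \<open>v\<close> annihilates the lower
    end.\<close>
  also have "(\<Sum>k<Suc n. v (Suc k) - v k) = v (Suc n)"
    by (subst sum_lessThan_telescope) (simp add: v_def)
  also have "v (Suc n) + u (Suc n) (Suc n)
      = (21 * of_nat (Suc n) + 8) * of_nat ((2 * Suc n) choose Suc n) ^ 3"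
  proof -
    define c where "c = (of_nat ((2 * Suc n) choose Suc n) :: rat)"
    \<comment> \<open>A central binomial coefficient is twice either of the two equal middle entries
      one row above; hence the \<open>c / 2\<close> in \<open>b\<close>.\<close>
    have "(2 * Suc n) choose Suc n = 2 * ((n + Suc n) choose Suc n)"
      using binomial_Suc_Suc[of "2 * n + 1" n] binomial_symmetric[of n "2 * n + 1"]
      by (simp add: mult_2)
    then have b: "of_nat ((n + Suc n) choose Suc n) = c / 2"
      unfolding c_def by simp
    have b': "of_nat ((Suc n + Suc n) choose Suc n) = c"
      unfolding c_def by (simp add: mult_2)
    have 1: "u (Suc n) (Suc n) = 4 * (z + 2) * (c * (2 * z + 4) * (2 * z + 3) / (z + 2) ^ 2) * c ^ 2"
      unfolding u_def C b' unfolding c_def by (simp add: z_def)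
    have 2: "v (Suc n) = 4 * (z + 1) * c * (c / 2) ^ 2 * (z + 1) ^ 2 * (5 * (z + 1)) / (z + 1) ^ 3"
      unfolding v_def u_def b unfolding c_def by (simp add: z_def algebra_simps)
    have "v (Suc n) + u (Suc n) (Suc n) = (21 * (z + 1) + 8) * c ^ 3"
      unfolding 1 2 using nz(1,2)
      by (simp add: divide_simps) (simp add: algebra_simps eval_nat_numeral)
    then show ?thesis by (simp add: c_def z_def add_ac)
  qed
  finally have "(\<Sum>k\<le>n. (21 * of_nat k + 8) * of_nat ((2 * k) choose k) ^ 3)
      + (21 * of_nat (Suc n) + 8) * of_nat ((2 * Suc n) choose Suc n) ^ 3 = (\<Sum>k\<le>Suc n. u (Suc n) k)"
    unfolding Suc.IH u_def sum_distrib_left by (rule sym)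
  then show ?case
    unfolding u_def sum_distrib_left[symmetric] by (subst sum.atMost_Suc)
qed

subsection \<open>Euler numbers modulo a prime\<close>

text \<open>Adding the two binomial expansions doubles the even terms and cancels the odd ones. This
  converts the Euler recursion, applied to powers, into closed form.\<close>

lemma sum_even_binomial:
  fixes x :: int
  shows "2 * (\<Sum>k\<in>{k\<in>{0..n}. even k}. int (n choose k) * x ^ (n - k)) = (x + 1) ^ n + (x - 1) ^ n"
proof -
  have "(1 + x) ^ n + (- 1 + x) ^ n
      = (\<Sum>k\<in>{0..n}. (1 + (-1) ^ k) * (int (n choose k) * x ^ (n - k)))"
    unfolding binomial_ring by (simp add: atLeast0AtMost algebra_simps flip: sum.distrib)
  also have "\<dots> = (\<Sum>k\<in>{0..n}. if even k then 2 * (int (n choose k) * x ^ (n - k)) else 0)"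
    by (intro sum.cong) auto
  also have "\<dots> = 2 * (\<Sum>k\<in>{k\<in>{0..n}. even k}. int (n choose k) * x ^ (n - k))"
    by (simp add: sum_distrib_left flip: sum.inter_filter)
  finally show ?thesis by (simp add: add.commute)
qed

text \<open>The bases are the consecutive even numbers \<open>2 * i + 2\<close> and
  \<open>2 * i\<close>, so the signs make everything cancel except the last power; the initial
  \<open>0 ^ n\<close> vanishes because \<open>n > 0\<close>.\<close>

lemma sum_alternating_telescope:
  fixes n :: nat
  assumes "n > 0"
  shows "(\<Sum>i<m. (-1) ^ i * ((2 * int i + 1 + 1) ^ n + (2 * int i + 1 - 1) ^ n)) = - ((-1) ^ m * (2 * int m) ^ n)"
  using assms by (induction m) (simp_all add: algebra_simps zero_power)

text \<open>Modulo an odd \<open>m\<close>, the alternating power sums over a full period satisfy the recursion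
  defining the Euler numbers.\<close>

lemma euler_number_cong_alternating_sum:
  assumes "odd m"
  shows "[euler_number n = (\<Sum>i<m. (-1) ^ i * (2 * int i + 1) ^ n)] (mod int m)"
proof (induction n rule: less_induct)
  case (less n)
  define D where "D n = (\<Sum>i<m. (-1) ^ i * (2 * int i + 1) ^ n)" for n
  show ?case
  proof (cases "n = 0")
    case True
    have "(\<Sum>i<m. (-1) ^ i :: int) = (if odd m then 1 else 0)" for m :: nat
      by (induction m) auto
    with True assms show ?thesis by (simp add: euler_number_0)
  next
    case False
    let ?A = "{k\<in>{1..n}. even k}"
    have eq: "{k\<in>{0..n}. even k} = insert 0 ?A"
      by (auto intro: Suc_leI gr0I)
    have split: "(\<Sum>k\<in>{k\<in>{0..n}. even k}. int (n choose k) * f (n - k))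
        = f n + (\<Sum>k\<in>?A. int (n choose k) * f (n - k))" for f :: "nat \<Rightarrow> int"
      unfolding eq by (subst sum.insert) auto
    have "2 * (\<Sum>k\<in>{k\<in>{0..n}. even k}. int (n choose k) * D (n - k))
        = (\<Sum>i<m. (-1) ^ i * (2 * (\<Sum>k\<in>{k\<in>{0..n}. even k}. int (n choose k) * (2 * int i + 1) ^ (n - k))))"
      unfolding D_def sum_distrib_left by (subst sum.swap) (simp add: mult_ac)
    \<comment> \<open>By telescoping, with sign \<open>+\<close> because \<open>m\<close> is odd;
      the result is a multiple of \<open>m\<close> since \<open>n > 0\<close>.\<close>
    also have "\<dots> = (2 * int m) ^ n"
      unfolding sum_even_binomial using sum_alternating_telescope[of n m] False assms by simp
    finally have "int m dvd 2 * (\<Sum>k\<in>{k\<in>{0..n}. even k}. int (n choose k) * D (n - k))"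
      using False by (simp add: power_mult_distrib)
    moreover have "coprime (int m) 2" using assms by simp
    ultimately have "[0 = D n + (\<Sum>k\<in>?A. int (n choose k) * D (n - k))] (mod int m)"
      by (metis split coprime_dvd_mult_right_iff cong_0_iff cong_sym)
    \<comment> \<open>The induction hypothesis replaces every lower \<open>D (n - k)\<close>;
      comparing with the exact recursion isolates index \<open>n\<close>.\<close>
    also have "[D n + (\<Sum>k\<in>?A. int (n choose k) * D (n - k))
        = D n + (\<Sum>k\<in>?A. int (n choose k) * euler_number (n - k))] (mod int m)"
      using less False unfolding D_def
      by (intro cong_add cong_sum cong_mult cong_refl) (auto intro!: less[THEN cong_sym])
    also have "0 = euler_number n + (\<Sum>k\<in>?A. int (n choose k) * euler_number (n - k))"
      using euler_number_recursion[of n] False split[of euler_number] by simp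
    finally show ?thesis unfolding D_def by (simp only: cong_add_rcancel)
  qed
qed

subsection \<open>Inverse squares modulo a prime\<close>

text \<open>For \<open>p = 2 * n + 1\<close> the upper half is indexed by \<open>p - k\<close>, the
  negative of \<open>k\<close> modulo \<open>p\<close>.\<close>

lemma sum_split_reflect:
  fixes f :: "nat \<Rightarrow> 'a :: comm_monoid_add"
  shows "(\<Sum>k=1..2 * n. f k) = (\<Sum>k=1..n. f k) + (\<Sum>k=1..n. f (2 * n + 1 - k))"
proof -
  have "{1..2 * n} = {1..n} \<union> {n+1..2 * n}" by auto
  then have "(\<Sum>k=1..2 * n. f k) = (\<Sum>k=1..n. f k) + (\<Sum>k=n+1..2 * n. f k)"
    by (simp add: sum.union_disjoint)
  also have "(\<Sum>k=n+1..2 * n. f k) = (\<Sum>k=1..n. f (2 * n + 1 - k))"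
    by (rule sum.reindex_bij_witness[of _ "\<lambda>k. 2 * n + 1 - k" "\<lambda>k. 2 * n + 1 - k"]) auto
  finally show ?thesis .
qed

text \<open>For \<open>p = 2 * n + 1\<close> the odd indices are \<open>p\<close> minus the even
  ones, so modulo \<open>p\<close> all indices are even up to sign.\<close>

lemma sum_split_parity:
  fixes f :: "nat \<Rightarrow> 'a :: comm_monoid_add"
  shows "(\<Sum>k=1..2 * n. f k) = (\<Sum>k=1..n. f (2 * k)) + (\<Sum>k=1..n. f (2 * n + 1 - 2 * k))"
proof -
  have "(\<Sum>k=1..2 * n. f k) = (\<Sum>k=1..n. f (2 * k)) + (\<Sum>k=1..n. f (2 * k - 1))"
    by (induction n) (simp_all add: add_ac)
  also have "(\<Sum>k=1..n. f (2 * k - 1)) = (\<Sum>k=1..n. f (2 * n + 1 - 2 * k))"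
    by (rule sum.reindex_bij_witness[of _ "\<lambda>k. n + 1 - k" "\<lambda>k. n + 1 - k"])
      (auto intro!: arg_cong[where f = f])
  finally show ?thesis .
qed

context prime_modulus
begin

lemma not_dvd_less: "0 < k \<Longrightarrow> k < p \<Longrightarrow> \<not> p dvd k"
  by (auto dest: dvd_imp_le)

lemma p_integral_inverse_less:
  "0 < k \<Longrightarrow> k < p \<Longrightarrow> inverse (of_nat k) \<in> p_integral p"
  by (simp add: p_integral_inverse_of_nat not_dvd_less)

text \<open>Fermat's theorem: the power \<open>p - 3\<close> acts as an inverse square, which is why
  the Euler number of index \<open>p - 3\<close> appears.\<close>

lemma power_prime_minus_3_cong:
  assumes "p > 3" "\<not> p dvd x"
  shows "p_cong p 1 (of_nat x ^ (p - 3) * of_nat x ^ 2) 1"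
proof -
  have "[int x ^ (p - 1) = 1] (mod int p ^ 1)"
    using fermat_theorem[OF p assms(2)] by (metis cong_int_iff of_nat_1 of_nat_power power_one_right)
  moreover have "p - 1 = p - 3 + 2" using assms(1) by simp
  ultimately show ?thesis
    using p_cong_of_int[of "int x ^ (p - 1)" 1 1] by (simp add: power_add power2_eq_square mult_ac)
qed

lemma of_nat_diff_cong: "k \<le> p \<Longrightarrow> p_cong p 1 (of_nat (p - k)) (- of_nat k)"
  using p_cong_diff[OF p_cong_of_nat_self p_cong_refl[of "of_nat k"]] by (simp add: of_nat_diff)

text \<open>The alternating power sum for the Euler number is symmetric about \<open>i = h\<close>,
  so it is twice its first half modulo \<open>p\<close>. There
  \<open>2 * i + 1 = p - 2 * (h - i)\<close>, whose power \<open>p - 3\<close> is the inverse of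
  \<open>4 * (h - i) ^ 2\<close>.\<close>

lemma alternating_inverse_squares_cong:
  assumes "p > 3" "p = 2 * h + 1"
  shows "p_cong p 1 (\<Sum>k=1..h. (-1) ^ k / of_nat k ^ 2) ((-1) ^ h * (2 * of_int (euler_number (p - 3))))"
proof -
  let ?g = "\<lambda>i. (-1) ^ i * (2 * of_nat i + 1) ^ (p - 3) :: rat"
  have ev: "even (p - 3)" and hp: "2 * h < p" using assms by simp_all
  have "p_cong p 1 (of_int (euler_number (p - 3))) (of_int (\<Sum>i<p. (-1) ^ i * (2 * int i + 1) ^ (p - 3)))"
    using euler_number_cong_alternating_sum[of p "p - 3"] assms by (intro p_cong_of_int) simp
  also have "of_int (\<Sum>i<p. (-1) ^ i * (2 * int i + 1) ^ (p - 3)) = (\<Sum>i<p. ?g i)"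
    by simp
  also have "(\<Sum>i<p. ?g i) = (\<Sum>i<h. ?g i) + (?g h + (\<Sum>i\<in>{h<..<p}. ?g i))"
  proof -
    have "{..<p} = {..<h} \<union> insert h {h<..<p}" using hp by auto
    then have "(\<Sum>i<p. ?g i) = (\<Sum>i\<in>{..<h} \<union> insert h {h<..<p}. ?g i)" by (rule arg_cong)
    also have "\<dots> = (\<Sum>i<h. ?g i) + (\<Sum>i\<in>insert h {h<..<p}. ?g i)"
      by (rule sum.union_disjoint) auto
    finally show ?thesis by simp
  qed
  also have "p_cong p 1 \<dots> ((\<Sum>i<h. ?g i) + (0 + (\<Sum>i<h. ?g i)))"
  proof (intro p_cong_add)
    show "p_cong p 1 (\<Sum>i<h. ?g i) (\<Sum>i<h. ?g i)"
      by (intro p_cong_refl p_integral_sum) simp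
    \<comment> \<open>The base of the middle term is \<open>p\<close> itself, and
      \<open>p > 3\<close> makes the exponent positive.\<close>
    have "(of_nat p :: rat) = 2 * of_nat h + 1" using assms(2) by simp
    then have "p_cong p 1 (?g h) ((-1) ^ h * 0 ^ (p - 3))"
      using p_cong_of_nat_self by (intro p_cong_mult p_cong_power p_cong_refl) simp_all
    then show "p_cong p 1 (?g h) 0" using assms(1) by (simp add: zero_power)
    \<comment> \<open>Reflection turns \<open>2 * i + 1\<close> into
      \<open>2 * p - (2 * i + 1)\<close>; the even exponent \<open>p - 3\<close> absorbs the
      sign.\<close>
    have "(\<Sum>i\<in>{h<..<p}. ?g i) = (\<Sum>i<h. ?g (2 * h - i))"
      by (rule sum.reindex_bij_witness[of _ "\<lambda>i. 2 * h - i" "\<lambda>i. 2 * h - i"]) (use assms in auto)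
    also have "p_cong p 1 \<dots> (\<Sum>i<h. ?g i)"
    proof (intro p_cong_sum p_cong_mult)
      fix i assume "i \<in> {..<h}"
      then have i: "i < h" by simp
      then show "p_cong p 1 ((-1) ^ (2 * h - i)) ((-1) ^ i)"
        by (simp add: p_cong_refl minus_one_power_iff)
      have "2 * of_nat (2 * h - i) + 1 = 2 * of_nat p - (2 * of_nat i + 1 :: rat)"
        using i assms(2) by (simp add: of_nat_diff)
      also have "p_cong p 1 \<dots> (2 * 0 - (2 * of_nat i + 1))"
        by (intro p_cong_diff p_cong_cmult p_cong_of_nat_self p_cong_refl) simp_all
      finally have "p_cong p 1 ((2 * of_nat (2 * h - i) + 1) ^ (p - 3)) ((- (2 * of_nat i + 1)) ^ (p - 3))"
        by (intro p_cong_power) simp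
      then show "p_cong p 1 ((2 * of_nat (2 * h - i) + 1) ^ (p - 3)) ((2 * of_nat i + 1) ^ (p - 3))"
        using ev by (simp only: power_minus_even)
    qed
    finally show "p_cong p 1 (\<Sum>i\<in>{h<..<p}. ?g i) (\<Sum>i<h. ?g i)" .
  qed
  also have "\<dots> = 2 * (\<Sum>i<h. ?g i)" by simp
  finally have E: "p_cong p 1 ((-1) ^ h * (2 * of_int (euler_number (p - 3)))) ((-1) ^ h * (2 * (2 * (\<Sum>i<h. ?g i))))"
    by (intro p_cong_cmult) simp_all
  have "(\<Sum>k=1..h. (-1) ^ k / of_nat k ^ 2) = (\<Sum>i<h. (-1) ^ (h - i) / of_nat (h - i) ^ 2 :: rat)"
    by (rule sum.reindex_bij_witness[of _ "\<lambda>i. h - i" "\<lambda>i. h - i"]) auto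
  also have "p_cong p 1 \<dots> (\<Sum>i<h. (-1) ^ h * (4 * ?g i))"
  proof (intro p_cong_sum)
    fix i assume "i \<in> {..<h}"
    then have i: "i < h" by simp
    define x where "x = 2 * i + 1"
    have x: "\<not> p dvd x" using i hp by (intro not_dvd_less) (auto simp: x_def)
    have px: "p - 2 * (h - i) = x" using i assms(2) by (simp add: x_def)
    have "p_cong p 1 (of_nat x ^ (p - 3) * of_nat x ^ 2)
        (of_nat x ^ (p - 3) * (- of_nat (2 * (h - i))) ^ 2)"
      using of_nat_diff_cong[of "2 * (h - i)"] hp unfolding px
      by (intro p_cong_cmult p_cong_power) simp_all
    from p_cong_trans[OF p_cong_sym[OF this] power_prime_minus_3_cong[OF assms(1) x]]
    have "p_cong p 1 (of_nat ((h - i) ^ 2) * (4 * of_nat x ^ (p - 3))) 1"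
      by (simp add: power_mult_distrib mult_ac)
    moreover have "\<not> p dvd (h - i) ^ 2"
      using not_dvd_less[of "h - i"] i hp prime_dvd_power[OF p, of "h - i" 2] by auto
    ultimately have "p_cong p 1 (inverse (of_nat ((h - i) ^ 2))) (4 * of_nat x ^ (p - 3))"
      by (intro p_cong_inverse_of_nat) simp_all
    then have "p_cong p 1 ((-1) ^ (h - i) * inverse (of_nat ((h - i) ^ 2))) ((-1) ^ (h - i) * (4 * of_nat x ^ (p - 3)))"
      by (intro p_cong_cmult) simp_all
    moreover have "(-1) ^ (h - i) = ((-1) ^ h * (-1) ^ i :: rat)"
      using i by (simp add: minus_one_power_iff)
    ultimately show "p_cong p 1 ((-1) ^ (h - i) / of_nat (h - i) ^ 2) ((-1) ^ h * (4 * ?g i))"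
      by (simp add: divide_inverse x_def add_ac mult_ac)
  qed
  also have "\<dots> = (-1) ^ h * (2 * (2 * (\<Sum>i<h. ?g i)))"
    by (simp add: sum_distrib_left)
  finally show ?thesis using p_cong_sym[OF E] by (rule p_cong_trans)
qed

subsection \<open>The two congruences\<close>

text \<open>The two exact identities at \<open>n = h\<close> express the sum by
  \<open>- 2 * A\<close> and two error sums, which cancel modulo \<open>p\<close> once one of them
  is reversed.\<close>

lemma reciprocal_cube_sum_cong:
  assumes "p > 3" "p = 2 * h + 1"
  shows "p_cong p 1
      (\<Sum>k=1..h. (21 * of_nat k - 8) / (of_nat k ^ 3 * of_nat ((2 * k) choose k) ^ 3))
      ((-1) ^ (h + 1) * 4 * of_int (euler_number (p - 3)))"
proof -
  define u where "u j = ((-1) ^ (h + j + 1) * fact j ^ 2 * fact (h - 1 - j) / fact (h + j + 1) :: rat)" for j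
  define f where "f k = (fact h ^ 4 * fact k ^ 2 / (fact (2 * h) * fact (h + k + 1) ^ 2) :: rat)" for k
  define A where "A = (\<Sum>k=1..h. (-1) ^ k / of_nat k ^ 2 :: rat)"
  have T: "(\<Sum>k=1..h. (21 * of_nat k - 8) / (of_nat k ^ 3 * of_nat ((2 * k) choose k) ^ 3))
      = - 2 * A - (\<Sum>j<h. u j) + (\<Sum>j<h. f (h - Suc j))"
    using inverse_square_central_sum_1[of h] inverse_square_central_sum_2[of h]
    unfolding u_def[symmetric] f_def[symmetric] A_def[symmetric] sum.nat_diff_reindex by linarith
  have hp: "2 * h < p" "p - 1 - h = h" using assms by simp_all
  \<comment> \<open>Since \<open>p - 1 - h = h\<close>, Wilson's theorem gives the square of
    \<open>fact h\<close> up to sign; squaring removes the sign.\<close>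
  have fact4: "p_cong p 1 (fact h ^ 4) 1"
  proof -
    have "p_cong p 1 (fact h * inverse (fact h)) (fact h * ((-1) ^ (h + 1) * fact (p - 1 - h)))"
      using hp(1) by (intro p_cong_cmult inverse_fact_cong) simp_all
    then have "p_cong p 1 ((fact h * ((-1) ^ (h + 1) * fact h)) ^ 2) (1 ^ 2)"
      unfolding hp(2) by (intro p_cong_power) (auto intro: p_cong_sym)
    then show ?thesis
      by (simp add: power_mult_distrib flip: power_mult power_add)
  qed
  have fu: "p_cong p 1 (f (h - Suc j)) (u j)" if "j < h" for j
  proof -
    have "f (h - Suc j) = fact h ^ 4 * (fact (h - Suc j) ^ 2 * (inverse (fact (p - 1)) * inverse (fact (p - 1 - j)) ^ 2))"
    proof -
      have e: "h + (h - Suc j) + 1 = p - 1 - j" "2 * h = p - 1" using that assms(2) by simp_all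
      show ?thesis unfolding f_def e
        by (simp add: divide_inverse power_mult_distrib power_inverse mult_ac)
    qed
    also have "p_cong p 1 \<dots> (1 * (fact (h - Suc j) ^ 2 * ((-1) ^ (p - 1 + 1) * fact (p - 1 - (p - 1)) *
        ((-1) ^ (p - 1 - j + 1) * fact (p - 1 - (p - 1 - j))) ^ 2)))"
      using that hp(1) by (intro p_cong_mult p_cong_power inverse_fact_cong p_cong_refl fact4) simp_all
    \<comment> \<open>The minus sign is \<open>(-1) ^ p\<close> for odd \<open>p\<close>; the other
      sign is squared.\<close>
    also have "\<dots> = - (fact (h - Suc j) ^ 2 * fact j ^ 2)"
      using that assms by (simp add: power_mult_distrib flip: power_mult)
    \<comment> \<open>One of the two factors \<open>fact (h - Suc j)\<close> is set aside to be
      turned back into an inverse factorial, as demanded by \<open>u j\<close>.\<close>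
    also have "\<dots> = (-1) ^ (h + j + 1) * fact j ^ 2 * fact (h - 1 - j) *
        ((-1) ^ (h + j + 1 + 1) * fact (p - 1 - (h + j + 1)))"
    proof -
      have "p - 1 - (h + j + 1) = h - Suc j" using that assms(2) by simp
      then show ?thesis by (simp add: power2_eq_square mult_ac flip: power_add)
    qed
    also have "p_cong p 1 \<dots> ((-1) ^ (h + j + 1) * fact j ^ 2 * fact (h - 1 - j) * inverse (fact (h + j + 1)))"
      using that hp(1) by (intro p_cong_cmult p_cong_sym[OF inverse_fact_cong]) simp_all
    also have "\<dots> = u j" by (simp add: u_def divide_inverse)
    finally show ?thesis .
  qed
  have A: "p_cong p 1 (- 2 * A) (- 2 * ((-1) ^ h * (2 * of_int (euler_number (p - 3)))))"
    unfolding A_def by (intro p_cong_cmult alternating_inverse_squares_cong assms) simp_all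
  have "p_cong p 1 (- 2 * A + ((\<Sum>j<h. f (h - Suc j)) - (\<Sum>j<h. u j)))
      (- 2 * ((-1) ^ h * (2 * of_int (euler_number (p - 3)))) + ((\<Sum>j<h. u j) - (\<Sum>j<h. u j)))"
  proof (intro p_cong_add p_cong_diff A)
    show fu': "p_cong p 1 (\<Sum>j<h. f (h - Suc j)) (\<Sum>j<h. u j)"
      using fu by (intro p_cong_sum) simp
    then show "p_cong p 1 (\<Sum>j<h. u j) (\<Sum>j<h. u j)"
      by (intro p_cong_refl) (simp add: p_cong_def)
  qed
  then show ?thesis unfolding T by (simp add: algebra_simps)
qed

section \<open>Wolstenholme-type congruences and the sum over all \<open>k < p\<close>\<close>

lemma inverse_of_nat_diff_cong:
  assumes "0 < k" "k < p"
  shows "p_cong p 1 (inverse (of_nat (p - k))) (- inverse (of_nat k))"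
proof (rule p_cong_inverse_of_nat)
  show "\<not> p dvd p - k" using assms by (intro not_dvd_less) simp_all
  show "- inverse (of_nat k) \<in> p_integral p"
    using assms by (simp add: p_integral_inverse_less)
  have "p_cong p 1 (- inverse (of_nat k) * of_nat (p - k)) (- inverse (of_nat k) * - of_nat k)"
    using assms by (intro p_cong_cmult of_nat_diff_cong) (simp_all add: p_integral_inverse_less)
  then show "p_cong p 1 (of_nat (p - k) * - inverse (of_nat k)) 1"
    using assms by (simp add: mult_ac)
qed

text \<open>With \<open>S\<close> the sum over the lower half, reflection gives the total
  \<open>2 * S\<close> and splitting by parity gives \<open>S / 2\<close>. Hence
  \<open>3 * S\<close> vanishes modulo \<open>p\<close>, and \<open>p > 3\<close> allows cancelling
  3.\<close>

lemma inverse_squares_cong_0: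
  assumes "p > 3"
  shows "p_cong p 1 (\<Sum>k=1..p-1. inverse (of_nat k) ^ 2) 0"
proof -
  obtain h where h: "p = 2 * h + 1"
    using prime_odd_nat[OF p] assms by (auto elim: oddE)
  then have hp: "2 * h < p" by simp
  define f where "f k = (inverse (of_nat k) ^ 2 :: rat)" for k
  define S where "S = (\<Sum>k=1..h. f k)"
  have int_f: "f k \<in> p_integral p" if "0 < k" "k < p" for k
    unfolding f_def using that by (simp add: p_integral_inverse_less)
  have int_S: "S \<in> p_integral p"
    unfolding S_def using hp by (intro p_integral_sum int_f) auto
  have reflect: "p_cong p 1 (f (2 * h + 1 - k)) (f k)" if "0 < k" "k < p" for k
    using p_cong_power[OF inverse_of_nat_diff_cong[OF that], of 2] h by (simp add: f_def)
  have 1: "p_cong p 1 (\<Sum>k=1..2 * h. f k) (S + S)"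
    unfolding sum_split_reflect S_def using hp int_f
    by (intro p_cong_add p_cong_sum reflect p_cong_refl) auto
  have "p_cong p 1 (\<Sum>k=1..2 * h. f k) ((\<Sum>k=1..h. f (2 * k)) + (\<Sum>k=1..h. f (2 * k)))"
    unfolding sum_split_parity using hp int_f
    by (intro p_cong_add p_cong_sum reflect p_cong_refl) auto
  also have "(\<Sum>k=1..h. f (2 * k)) + (\<Sum>k=1..h. f (2 * k)) = S / 2"
    unfolding S_def f_def by (simp add: sum_divide_distrib power_mult_distrib power2_eq_square flip: sum.distrib)
  finally have "p_cong p 1 (S + S) (S / 2)"
    by (rule p_cong_trans[OF p_cong_sym[OF 1]])
  then have "p_cong p 1 (2 * (S + S) - S) (2 * (S / 2) - S)"
    using int_S by (intro p_cong_diff p_cong_cmult p_cong_refl) simp_all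
  then have "p_cong p 1 (of_nat 3 * S) (of_nat 3 * 0)" by simp
  then have "p_cong p 1 S 0"
    using assms not_dvd_less[of 3] by (intro p_cong_cancel_of_nat[of 3 1 S 0]) simp_all
  from p_cong_trans[OF 1 p_cong_add[OF this this]] have "p_cong p 1 (\<Sum>k=1..2 * h. f k) 0" by simp
  then show ?thesis using h by (simp add: f_def)
qed

text \<open>Common core of the next two results: the squares carry \<open>p ^ 2\<close>, and the
  remaining sum reduces to the inverse squares modulo \<open>p\<close>.\<close>

lemma sum_squares_shift_cong:
  assumes "p > 3"
    and "\<And>k. 0 < k \<Longrightarrow> k < p \<Longrightarrow> f k = of_nat p * (g k * inverse (of_nat k))"
    and "\<And>k. 0 < k \<Longrightarrow> k < p \<Longrightarrow> p_cong p 1 (g k ^ 2) 1"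
  shows "p_cong p 3 (\<Sum>k=1..p-1. f k ^ 2) 0"
proof -
  have "p_cong p 1 (\<Sum>k=1..p-1. g k ^ 2 * inverse (of_nat k) ^ 2) (\<Sum>k=1..p-1. 1 * inverse (of_nat k) ^ 2)"
    using assms(3) by (intro p_cong_sum p_cong_mult p_cong_refl p_integral_power p_integral_inverse_less) auto
  then have "p_cong p 1 (\<Sum>k=1..p-1. g k ^ 2 * inverse (of_nat k) ^ 2) 0"
    by (rule p_cong_trans) (use inverse_squares_cong_0[OF assms(1)] in simp)
  then have "p_cong p (1 + 2) (of_nat p ^ 2 * (\<Sum>k=1..p-1. g k ^ 2 * inverse (of_nat k) ^ 2)) (of_nat p ^ 2 * 0)"
    by (rule p_cong_shift)
  also have "of_nat p ^ 2 * (\<Sum>k=1..p-1. g k ^ 2 * inverse (of_nat k) ^ 2) = (\<Sum>k=1..p-1. f k ^ 2)"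
    unfolding sum_distrib_left by (intro sum.cong refl) (auto simp: assms(2) power_mult_distrib)
  finally show ?thesis by (simp add: numeral_3_eq_3)
qed

text \<open>The squares of row \<open>p\<close> of Pascal's triangle add up to the central binomial
  coefficient; the two outer entries give 2, and the inner ones are \<open>p / k\<close> times an
  entry that is 1 or -1 modulo \<open>p\<close>.\<close>

lemma wolstenholme_central_binomial:
  assumes "p > 3"
  shows "p_cong p 3 (of_nat ((2 * p) choose p)) 2"
proof -
  have "p_cong p 3 (\<Sum>k=1..p-1. of_nat (p choose k) ^ 2) 0"
  proof (rule sum_squares_shift_cong[OF assms])
    fix k assume k: "0 < k" "k < p"
    have "k * (p choose k) = p * ((p - 1) choose (k - 1))"
      using k by (intro times_binomial_minus1_eq)
    then have "of_nat k * of_nat (p choose k) = (of_nat p * of_nat ((p - 1) choose (k - 1)) :: rat)"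
      by (metis of_nat_mult)
    then show "of_nat (p choose k) = (of_nat p * (of_nat ((p - 1) choose (k - 1)) * inverse (of_nat k)) :: rat)"
      using k by (simp add: field_simps)
    show "p_cong p 1 (of_nat ((p - 1) choose (k - 1)) ^ 2) 1"
      using p_cong_power[OF choose_prime_minus_1_cong[of "k - 1"], of 2] k by (simp flip: power_mult)
  qed
  then have "p_cong p 3 (2 + (\<Sum>k=1..p-1. of_nat (p choose k) ^ 2)) (2 + 0)"
    by (intro p_cong_add p_cong_refl) simp
  also have "2 + (\<Sum>k=1..p-1. of_nat (p choose k) ^ 2) = (of_nat (\<Sum>k\<le>p. (p choose k) ^ 2) :: rat)"
  proof -
    have "{..p} = insert 0 (insert p {1..p-1})" using assms by auto
    then show ?thesis using assms by (simp only:) (subst sum.insert, auto)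
  qed
  finally show ?thesis by (simp add: choose_square_sum)
qed

text \<open>In \<open>central_binomial_cube_sum\<close> at \<open>n = p - 1\<close>, the sum of
  squares is 1 and the central binomial coefficient is 2 modulo \<open>p ^ 3\<close>; the explicit
  factor \<open>p\<close> lifts the result to \<open>p ^ 4\<close>.\<close>

lemma central_binomial_cube_sum_cong:
  assumes "p > 3"
  shows "p_cong p 4 (\<Sum>k\<le>p-1. (21 * of_nat k + 8) * of_nat ((2 * k) choose k) ^ 3) (8 * of_nat p)"
proof -
  have "p_cong p 3 (\<Sum>k=1..p-1. of_nat ((p - 1 + k) choose k) ^ 2) 0"
  proof (rule sum_squares_shift_cong[OF assms])
    fix k assume k: "0 < k" "k < p"
    then obtain j where j: "k = Suc j" by (cases k) auto
    have "k * ((p - 1 + k) choose k) = p * ((p - 1 + k) choose j)"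
      using binomial_absorb_comp[of "p - 1 + k" j] binomial_absorption[of j "p - 1 + k"] k
      by (simp add: j)
    moreover have "p - 1 + k = p + j" using k j by simp
    ultimately have "k * ((p - 1 + k) choose k) = p * ((p + j) choose j)" by simp
    then have "of_nat k * of_nat ((p - 1 + k) choose k) = (of_nat p * of_nat ((p + j) choose j) :: rat)"
      by (metis of_nat_mult)
    then show "of_nat ((p - 1 + k) choose k)
        = (of_nat p * (of_nat ((p + (k - 1)) choose (k - 1)) * inverse (of_nat k)) :: rat)"
      using k by (simp add: field_simps j)
    show "p_cong p 1 (of_nat ((p + (k - 1)) choose (k - 1)) ^ 2) 1"
      using p_cong_power[OF choose_add_cong[of "k - 1"], of 2] k by simp
  qed
  then have "p_cong p 3 (1 + (\<Sum>k=1..p-1. of_nat ((p - 1 + k) choose k) ^ 2)) (1 + 0)"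
    by (intro p_cong_add p_cong_refl) simp
  also have "1 + (\<Sum>k=1..p-1. of_nat ((p - 1 + k) choose k) ^ 2) = (\<Sum>k\<le>p-1. of_nat ((p - 1 + k) choose k) ^ 2 :: rat)"
    by (simp add: atMost_atLeast0 sum.atLeast_Suc_atMost)
  finally have "p_cong p 3 (4 * (of_nat ((2 * p) choose p) * (\<Sum>k\<le>p-1. of_nat ((p - 1 + k) choose k) ^ 2))) (4 * (2 * 1))"
    using assms by (intro p_cong_cmult p_cong_mult wolstenholme_central_binomial) simp_all
  from p_cong_shift[OF this, of 1] show ?thesis
    using central_binomial_cube_sum[of "p - 1"] assms by (simp add: mult_ac)
qed

text \<open>The factorial of \<open>2 * (p - j) = p + m\<close> contains \<open>p\<close> exactly
  once, as \<open>0 < m < p\<close>. Splitting off that \<open>p\<close> as an exact factor means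
  that, after cubing, \<open>w\<close> is needed only modulo \<open>p\<close>.\<close>

lemma central_binomial_reflect_cong:
  assumes "0 < j" "2 * j < p"
  obtains w where "of_nat ((2 * (p - j)) choose (p - j)) = of_nat p * w"
    "p_cong p 1 w (- 2 / (of_nat j * of_nat ((2 * j) choose j)))"
proof
  define m where "m = p - 2 * j"
  let ?w = "of_nat ((p + m) choose m) * (fact m * (fact (p - 1) * inverse (fact (p - j)) ^ 2)) :: rat"
  have pm: "2 * (p - j) = p + m" using assms by (simp add: m_def)
  have "fact (p + m) = of_nat ((p + m) choose m) * (fact m * (of_nat p * fact (p - 1)) :: rat)"
    using fact_reduce[of p, where ?'a = rat] prime_gt_0_nat[OF p] by (simp add: binomial_fact)
  then show "of_nat ((2 * (p - j)) choose (p - j)) = of_nat p * ?w"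
    unfolding central_binomial_eq unfolding pm by (simp add: field_simps)
  have m: "p - 1 - (2 * j - 1) = m" using assms by (simp add: m_def)
  have "p_cong p 1 (fact m) (inverse (fact (2 * j - 1)))"
    using p_cong_sym[OF inverse_fact_cong[of "2 * j - 1"]] assms unfolding m by simp
  moreover have "p_cong p 1 (inverse (fact (p - j)) ^ 2) (((-1) ^ (p - j + 1) * fact (j - 1)) ^ 2)"
    using p_cong_power[OF inverse_fact_cong[of "p - j"], of 2] assms by simp
  moreover have "p_cong p 1 (fact (p - 1)) (- 1)"
    using p_cong_of_int[of "fact (p - 1)" "-1" 1] wilson_theorem[OF p] by simp
  moreover have "p_cong p 1 (of_nat ((p + m) choose m)) 1"
    using assms by (intro choose_add_cong) (simp add: m_def)
  ultimately have "p_cong p 1 ?w (1 * (inverse (fact (2 * j - 1)) * (- 1 * ((-1) ^ (p - j + 1) * fact (j - 1)) ^ 2)))"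
    by (intro p_cong_mult)
  also have "\<dots> = - (fact (j - 1) ^ 2 / fact (2 * j - 1))"
    by (simp add: power_mult_distrib field_simps flip: power_mult)
  also have "\<dots> = - 2 / (of_nat j * of_nat ((2 * j) choose j))"
  proof -
    have "fact (2 * j) = 2 * of_nat j * (fact (2 * j - 1) :: rat)" "fact j = of_nat j * (fact (j - 1) :: rat)"
      using assms fact_reduce[of "2 * j", where ?'a = rat] fact_reduce[of j, where ?'a = rat] by simp_all
    then show ?thesis
      unfolding central_binomial_eq using assms by (simp add: power2_eq_square field_simps)
  qed
  finally show "p_cong p 1 ?w (- 2 / (of_nat j * of_nat ((2 * j) choose j)))" .
qed

text \<open>The half sum is the full sum minus the terms at \<open>p - k\<close>. Each of those is
  \<open>p ^ 3\<close> times a quantity that modulo \<open>p\<close> is 8 times a term of the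
  reciprocal sum.\<close>

lemma central_binomial_cube_half_sum_cong:
  assumes "p > 3" "p = 2 * h + 1"
  shows "p_cong p 4 (\<Sum>k=0..h. (21 * of_nat k + 8) * of_nat ((2 * k) choose k) ^ 3)
      (8 * of_nat p + (-1) ^ h * 32 * of_nat p ^ 3 * of_int (euler_number (p - 3)))"
proof -
  define f where "f k = ((21 * of_nat k + 8) * of_nat ((2 * k) choose k) ^ 3 :: rat)" for k
  define T where "T = (\<Sum>k=1..h. (21 * of_nat k - 8) / (of_nat k ^ 3 * of_nat ((2 * k) choose k) ^ 3) :: rat)"
  define e where "e = ((-1) ^ h * of_int (euler_number (p - 3)) :: rat)"
  have "p_cong p 4 (\<Sum>k=1..h. f (p - k))
      (\<Sum>k=1..h. of_nat p ^ 3 * (8 * ((21 * of_nat k - 8) / (of_nat k ^ 3 * of_nat ((2 * k) choose k) ^ 3))))"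
  proof (rule p_cong_sum)
    fix k assume "k \<in> {1..h}"
    then have k: "0 < k" "2 * k < p" using assms by auto
    let ?c = "- 2 / (of_nat k * of_nat ((2 * k) choose k)) :: rat"
    obtain w where w: "of_nat ((2 * (p - k)) choose (p - k)) = of_nat p * w" "p_cong p 1 w ?c"
      using k by (rule central_binomial_reflect_cong)
    have "p_cong p 1 ((21 * of_nat (p - k) + 8) * w ^ 3) ((21 * (- of_nat k) + 8) * ?c ^ 3)"
      using k by (intro p_cong_mult p_cong_add p_cong_cmult p_cong_power p_cong_refl of_nat_diff_cong w) simp_all
    from p_cong_shift[OF this, of 3]
    have "p_cong p 4 (of_nat p ^ 3 * ((21 * of_nat (p - k) + 8) * w ^ 3)) (of_nat p ^ 3 * ((21 * (- of_nat k) + 8) * ?c ^ 3))"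
      by simp
    moreover have "f (p - k) = of_nat p ^ 3 * ((21 * of_nat (p - k) + 8) * w ^ 3)"
      unfolding f_def w(1) by (simp add: power_mult_distrib)
    \<comment> \<open>The cube of -2 supplies the 8, and its sign turns \<open>8 - 21 * k\<close>
      into \<open>21 * k - 8\<close>.\<close>
    moreover have "(21 * (- of_nat k) + 8) * ?c ^ 3
        = 8 * ((21 * of_nat k - 8) / (of_nat k ^ 3 * of_nat ((2 * k) choose k) ^ 3))"
      by (simp add: power_mult_distrib power_inverse divide_inverse algebra_simps)
    ultimately show "p_cong p 4 (f (p - k))
      (of_nat p ^ 3 * (8 * ((21 * of_nat k - 8) / (of_nat k ^ 3 * of_nat ((2 * k) choose k) ^ 3))))"
      by (simp only:)
  qed
  also have "\<dots> = of_nat p ^ 3 * (8 * T)"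
    by (simp add: T_def sum_distrib_left)
  also have "p_cong p 4 \<dots> (of_nat p ^ 3 * (8 * ((-1) ^ (h + 1) * 4 * of_int (euler_number (p - 3)))))"
    using p_cong_shift[OF p_cong_cmult[of 8, OF p_integral_numeral reciprocal_cube_sum_cong[OF assms]], of 3]
    unfolding T_def by simp
  also have "of_nat p ^ 3 * (8 * ((-1) ^ (h + 1) * 4 * of_int (euler_number (p - 3)))) = - (32 * of_nat p ^ 3 * e)"
    by (simp add: e_def)
  finally have tail: "p_cong p 4 (\<Sum>k=1..h. f (p - k)) (- (32 * of_nat p ^ 3 * e))"
    by simp
  have full: "p_cong p 4 (\<Sum>k\<le>p-1. f k) (8 * of_nat p)"
    unfolding f_def using assms(1) by (rule central_binomial_cube_sum_cong)
  have "(\<Sum>k\<le>p-1. f k) = f 0 + (\<Sum>k=1..2 * h. f k)"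
    using assms(2) by (simp add: atMost_atLeast0 sum.atLeast_Suc_atMost)
  also have "\<dots> = (\<Sum>k=0..h. f k) + (\<Sum>k=1..h. f (p - k))"
    unfolding sum_split_reflect using assms(2) by (simp add: sum.atLeast_Suc_atMost add_ac)
  finally have "(\<Sum>k=0..h. f k) = (\<Sum>k\<le>p-1. f k) - (\<Sum>k=1..h. f (p - k))"
    by simp
  also have "p_cong p 4 \<dots> (8 * of_nat p - (- (32 * of_nat p ^ 3 * e)))"
    using full tail by (rule p_cong_diff)
  finally show ?thesis by (simp add: f_def e_def mult_ac)
qed

end

theorem theorem1p4:
  fixes p :: nat
  assumes "prime p" and "p > 3"
  shows "[(\<Sum>k=0..(p - 1) div 2. (21 * int k + 8) * int ((2 * k) choose k) ^ 3)
           = 8 * int p + (-1) ^ ((p - 1) div 2) * 32 * int p ^ 3 * euler_number (p - 3)]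
          (mod int p ^ 4)
       \<and> p_cong p 1
           (\<Sum>k=1..(p - 1) div 2.
              (21 * rat_of_nat k - 8) / (rat_of_nat k ^ 3 * rat_of_nat ((2 * k) choose k) ^ 3))
           ((-1) ^ ((p + 1) div 2) * 4 * rat_of_int (euler_number (p - 3)))"
proof
  interpret prime_modulus p by unfold_locales fact
  obtain h where h: "p = 2 * h + 1"
    using prime_odd_nat[OF assms(1)] assms(2) by (auto elim: oddE)
  then have h': "(p - 1) div 2 = h" "(p + 1) div 2 = h + 1" by simp_all
  show "[(\<Sum>k=0..(p - 1) div 2. (21 * int k + 8) * int ((2 * k) choose k) ^ 3)
           = 8 * int p + (-1) ^ ((p - 1) div 2) * 32 * int p ^ 3 * euler_number (p - 3)]
          (mod int p ^ 4)"
    \<comment> \<open>Both sides are integers, so the integer congruence may be proved among the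
      \<open>p\<close>-integral rationals.\<close>
    unfolding h' p_cong_of_int_iff[OF assms(1), symmetric]
    using central_binomial_cube_half_sum_cong[OF assms(2) h] by simp
  show "p_cong p 1
           (\<Sum>k=1..(p - 1) div 2.
              (21 * rat_of_nat k - 8) / (rat_of_nat k ^ 3 * rat_of_nat ((2 * k) choose k) ^ 3))
           ((-1) ^ ((p + 1) div 2) * 4 * rat_of_int (euler_number (p - 3)))"
    unfolding h' using assms(2) h by (rule reciprocal_cube_sum_cong)
qed

end
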